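(* Assume (A1) the vectors $Y_1,Y_2,\dots$ are i.i.d. in $\mathbb{R}^K$ and $Y_i$ is independent of $\mathcal{F}_{i-1}$ for every $i\ge 1$; (A2) $\mathbb{E}[Y_1]=0$; (A3) $\mathbb{E}[\max_{1\le k\le K}|Y_{1,k}|]<\infty$. Let $T$ be a stopping time with respect to $(\mathcal{F}_n)_{n\ge 0}$ satisfying $\mathbb{E}[T]<\infty$. Then $$\mathbb{E}[M_T]=\mathbb{E}\Bigl[\max_{1\le k\le K}S_{T,k}\Bigr]=\sum_{i=1}^{\infty}\mathbb{E}\bigl[\varphi_K(S_{i-1})\,\mathbf{1}\{T\ge i\}\bigr].$$
   Context: Fix an integer $K\ge 1$ and a probability space $(\Omega,\mathcal{F},P)$. Let $X_1,X_2,\dots$ be i.i.d. random elements of a measurable space $\mathcal{X}$ (with generic copy $X$), and for $k\in\{1,\dots,K\}$ let $f_k:\mathcal{X}\to\mathbb{R}$ be measurable with mean $\mu_k=\mathbb{E}[f_k(X)]$. Put $Y_{i,k}=f_k(X_i)-\mu_k$ and $Y_i=(Y_{i,1},\dots,Y_{i,K})\in\mathbb{R}^K$ (the coordinates of $Y_i$ may be dependent). Let $S_{n,k}=\sum_{i=1}^n Y_{i,k}$, $S_n=(S_{n,1},\dots,S_{n,K})$, $S_0=(0,\dots,0)\in\mathbb{R}^K$, and $M_n=\max_{1\le k\le K}S_{n,k}$. The filtration is $\mathcal{F}_n=\sigma(X_1,\dots,X_n)$, with $\mathcal{F}_0=\{\emptyset,\Omega\}$. $\mathbf{1}\{\cdot\}$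 denotes an indicator. The selection premium function $\varphi_K:\mathbb{R}^K\to\mathbb{R}$ is $$\varphi_K(u)=\mathbb{E}\Bigl[\max_{1\le k\le K}(u_k+Y_k)\Bigr]-\max_{1\le k\le K}u_k,$$ where $Y=(Y_1,\dots,Y_K)$ inside this formula denotes a random vector with the same distribution as the increment vector $(Y_{1,1},\dots,Y_{1,K})$. *)

theory Defs
  imports "HOL-Probability.Probability"
begin

text \<open>
  \<open>P\<close> is the underlying probability space and \<open>X 1, X 2, \<dots>\<close> is the sequence of random elements
  (\<open>X 0\<close> is never used). The index set \<open>{1, \<dots>, K}\<close> is a finite type \<open>'k\<close>, so
  \<open>K = CARD('k) \<ge> 1\<close>.
\<close>

text \<open>The generic copy of the random element is taken to be \<open>X 1\<close>.\<close>

definition mean :: "'a measure \<Rightarrow> (nat \<Rightarrow> 'a \<Rightarrow> 'x) \<Rightarrow> ('k \<Rightarrow> 'x \<Rightarrow> real) \<Rightarrow> 'k \<Rightarrow> real" where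
  "mean P X f k = (\<integral>\<omega>. f k (X 1 \<omega>) \<partial>P)"

definition incr ::
  "'a measure \<Rightarrow> (nat \<Rightarrow> 'a \<Rightarrow> 'x) \<Rightarrow> ('k::finite \<Rightarrow> 'x \<Rightarrow> real) \<Rightarrow> nat \<Rightarrow> 'a \<Rightarrow> real ^ 'k" where
  "incr P X f i \<omega> = (\<chi> k. f k (X i \<omega>) - mean P X f k)"

definition walk ::
  "'a measure \<Rightarrow> (nat \<Rightarrow> 'a \<Rightarrow> 'x) \<Rightarrow> ('k::finite \<Rightarrow> 'x \<Rightarrow> real) \<Rightarrow> nat \<Rightarrow> 'a \<Rightarrow> real ^ 'k" where
  "walk P X f n \<omega> = (\<Sum>i=1..n. incr P X f i \<omega>)"

definition walk_max ::
  "'a measure \<Rightarrow> (nat \<Rightarrow> 'a \<Rightarrow> 'x) \<Rightarrow> ('k::finite \<Rightarrow> 'x \<Rightarrow> real) \<Rightarrow> nat \<Rightarrow> 'a \<Rightarrow> real" where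
  "walk_max P X f n \<omega> = (MAX k. walk P X f n \<omega> $ k)"

text \<open>
  Stopping times may take the value \<open>\<infinity>\<close>. The filtration is therefore indexed by \<open>enat\<close>, so that
  \<open>stopping_time\<close> applies to \<open>enat\<close>-valued times. At \<open>\<infinity>\<close> it is the \<open>\<sigma>\<close>-algebra generated by all
  \<open>X i\<close>; the stopping time condition there, on the event \<open>T \<le> \<infinity>\<close>, is vacuous.
  At \<open>0\<close> the generator is empty, giving the trivial \<open>\<sigma>\<close>-algebra.
\<close>

definition natural_filtration ::
  "'a measure \<Rightarrow> 'x measure \<Rightarrow> (nat \<Rightarrow> 'a \<Rightarrow> 'x) \<Rightarrow> enat \<Rightarrow> 'a measure" where
  "natural_filtration P N X n =
     sigma (space P) {X i -` A \<inter> space P | i A. 1 \<le> i \<and> enat i \<le> n \<and> A \<in> sets N}"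

text \<open>
  The value of the process \<open>Z\<close> at the random time \<open>T\<close>, set to \<open>0\<close> on the event \<open>T = \<infinity>\<close>, which is
  null whenever \<open>T\<close> has finite expectation.
\<close>

definition stopped_at :: "(nat \<Rightarrow> 'a \<Rightarrow> 'b::zero) \<Rightarrow> ('a \<Rightarrow> enat) \<Rightarrow> 'a \<Rightarrow> 'b" where
  "stopped_at Z T \<omega> = (case T \<omega> of enat n \<Rightarrow> Z n \<omega> | \<infinity> \<Rightarrow> 0)"

text \<open>The argument \<open>D\<close> is the law of the random vector \<open>Y\<close> in \<open>\<phi>\<^sub>K\<close>.\<close>

definition selection_premium :: "(real ^ 'k::finite) measure \<Rightarrow> real ^ 'k \<Rightarrow> real" where
  "selection_premium D u = (\<integral>y. (MAX k. u $ k + y $ k) \<partial>D) - (MAX k. u $ k)"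

end

theory Submission
  imports Defs
begin

text \<open>
  The increment \<open>M\<^sub>i - M\<^sub>i\<^sub>-\<^sub>1\<close> is bounded by \<open>max\<^sub>k \<bar>Y\<^sub>i\<^sub>,\<^sub>k\<bar>\<close>, and \<open>M\<^sub>T\<close> is the sum over \<open>i\<close> of these increments
  restricted to \<open>{T \<ge> i}\<close>. As \<open>Y\<^sub>i\<close> is independent of \<open>F\<^sub>i\<^sub>-\<^sub>1\<close>, which determines \<open>S\<^sub>i\<^sub>-\<^sub>1\<close> and \<open>{T \<ge> i}\<close>,
  integrating out \<open>Y\<^sub>i\<close> turns the \<open>i\<close>-th term into \<open>\<phi>\<^sub>K(S\<^sub>i\<^sub>-\<^sub>1)\<close> on \<open>{T \<ge> i}\<close>; it also bounds the absolute
  first moment of that term by \<open>E[max\<^sub>k \<bar>Y\<^sub>1\<^sub>,\<^sub>k\<bar>] P(T \<ge> i)\<close>. These bounds sum to a multiple of \<open>E[T]\<close>, so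
  the series may be integrated termwise.
\<close>

section \<open>Integrating out an independent component\<close>

text \<open>Independence makes the joint law of \<open>Z\<close> and \<open>Y\<close> a product of
  their laws, which only has to be checked on rectangles; Fubini then allows \<open>Y\<close> to be
  integrated first with \<open>Z\<close> frozen. Independence is phrased through generated
  \<sigma>-algebras to fit independence of an increment from the past.\<close>

lemma (in prob_space)
  fixes g :: "'b \<times> 'c \<Rightarrow> 'd::{banach, second_countable_topology}"
  assumes Z [measurable]: "Z \<in> measurable M A" and Y [measurable]: "Y \<in> measurable M B"
    and ind: "indep_set (sets (vimage_algebra (space M) Z A)) (sets (vimage_algebra (space M) Y B))"
    and g [measurable]: "g \<in> borel_measurable (A \<Otimes>\<^sub>M B)"
    and int: "integrable M (\<lambda>\<omega>. g (Z \<omega>, Y \<omega>))"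
  shows integrable_indep_fst: "integrable M (\<lambda>\<omega>. \<integral>y. g (Z \<omega>, y) \<partial>distr M B Y)"
    and integral_indep_fst:
      "(\<integral>\<omega>. (\<integral>y. g (Z \<omega>, y) \<partial>distr M B Y) \<partial>M) = (\<integral>\<omega>. g (Z \<omega>, Y \<omega>) \<partial>M)"
proof -
  interpret Z: prob_space "distr M A Z" by (rule prob_space_distr) fact
  interpret Y: prob_space "distr M B Y" by (rule prob_space_distr) fact
  interpret ZY: pair_sigma_finite "distr M A Z" "distr M B Y" ..
  have joint: "distr M A Z \<Otimes>\<^sub>M distr M B Y = distr M (A \<Otimes>\<^sub>M B) (\<lambda>\<omega>. (Z \<omega>, Y \<omega>))"
  proof (rule pair_measure_eqI)
    fix U V assume "U \<in> sets (distr M A Z)" "V \<in> sets (distr M B Y)"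
    then have [measurable]: "U \<in> sets A" "V \<in> sets B" by auto
    have "prob ((Z -` U \<inter> space M) \<inter> (Y -` V \<inter> space M))
        = prob (Z -` U \<inter> space M) * prob (Y -` V \<inter> space M)"
      by (rule indep_setD[OF ind]) (auto intro: in_vimage_algebra)
    moreover have "(\<lambda>\<omega>. (Z \<omega>, Y \<omega>)) -` (U \<times> V) \<inter> space M
        = (Z -` U \<inter> space M) \<inter> (Y -` V \<inter> space M)"
      by auto
    ultimately show "emeasure (distr M A Z) U * emeasure (distr M B Y) V
        = emeasure (distr M (A \<Otimes>\<^sub>M B) (\<lambda>\<omega>. (Z \<omega>, Y \<omega>))) (U \<times> V)"
      by (simp add: emeasure_distr emeasure_eq_measure ennreal_mult)
  qed (auto simp: Z.sigma_finite_measure_axioms Y.sigma_finite_measure_axioms)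
  have joint_int: "integrable (distr M A Z \<Otimes>\<^sub>M distr M B Y) g"
    unfolding joint by (subst integrable_distr_eq) (use int in auto)
  have meas: "(\<lambda>z. \<integral>y. g (z, y) \<partial>distr M B Y) \<in> borel_measurable A"
    by measurable
  show "integrable M (\<lambda>\<omega>. \<integral>y. g (Z \<omega>, y) \<partial>distr M B Y)"
    using ZY.integrable_fst'[OF joint_int] meas by (subst (asm) integrable_distr_eq) auto
  have "(\<integral>\<omega>. (\<integral>y. g (Z \<omega>, y) \<partial>distr M B Y) \<partial>M)
      = (\<integral>z. (\<integral>y. g (z, y) \<partial>distr M B Y) \<partial>distr M A Z)"
    using meas by (subst integral_distr[OF Z]) auto
  also have "\<dots> = (\<integral>p. g p \<partial>distr M (A \<Otimes>\<^sub>M B) (\<lambda>\<omega>. (Z \<omega>, Y \<omega>)))"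
    using ZY.integral_fst'[OF joint_int] by (simp add: joint)
  also have "\<dots> = (\<integral>\<omega>. g (Z \<omega>, Y \<omega>) \<partial>M)"
    by (subst integral_distr) auto
  finally show "(\<integral>\<omega>. (\<integral>y. g (Z \<omega>, y) \<partial>distr M B Y) \<partial>M) = (\<integral>\<omega>. g (Z \<omega>, Y \<omega>) \<partial>M)" .
qed

section \<open>Coordinate maxima and the premium function\<close>

lemma borel_measurable_vec_nth [measurable]:
  "(\<lambda>x :: real ^ 'k::finite. x $ k) \<in> borel_measurable borel"
  by (intro borel_measurable_continuous_onI continuous_intros)

lemma borel_measurable_vec_lambda:
  fixes g :: "'k::finite \<Rightarrow> 'b \<Rightarrow> real"
  assumes "\<And>k. g k \<in> borel_measurable M"
  shows "(\<lambda>x. \<chi> k. g k x) \<in> borel_measurable M"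
  using assms
  by (subst borel_measurable_euclidean_space) (auto simp: Basis_vec_def inner_axis)

lemma borel_measurable_Max_vec [measurable]:
  "(\<lambda>x :: real ^ 'k::finite. MAX k. x $ k) \<in> borel_measurable borel"
  "(\<lambda>x :: real ^ 'k::finite. MAX k. \<bar>x $ k\<bar>) \<in> borel_measurable borel"
  by measurable

text \<open>The maximum is 1-Lipschitz in the sup norm. The bound does not depend on
  \<open>u\<close>, so it dominates the change of the maximum from every position of the
  walk.\<close>

lemma abs_Max_add_diff_le:
  fixes u y :: "'k::finite \<Rightarrow> real"
  shows "\<bar>(MAX k. u k + y k) - (MAX k. u k)\<bar> \<le> (MAX k. \<bar>y k\<bar>)"
proof -
  have y: "\<bar>y k\<bar> \<le> (MAX k. \<bar>y k\<bar>)" and u: "u k \<le> (MAX k. u k)"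
    and uy: "u k + y k \<le> (MAX k. u k + y k)" for k
    by (auto intro!: Max_ge)
  have "(MAX k. u k + y k) \<le> (MAX k. u k) + (MAX k. \<bar>y k\<bar>)"
  proof (intro Max.boundedI; clarsimp)
    show "u k + y k \<le> (MAX k. u k) + (MAX k. \<bar>y k\<bar>)" for k
      using y[of k] u[of k] by linarith
  qed
  moreover have "(MAX k. u k) \<le> (MAX k. u k + y k) + (MAX k. \<bar>y k\<bar>)"
  proof (intro Max.boundedI; clarsimp)
    show "u k \<le> (MAX k. u k + y k) + (MAX k. \<bar>y k\<bar>)" for k
      using y[of k] uy[of k] by linarith
  qed
  ultimately show ?thesis by linarith
qed

text \<open>Since \<open>D\<close> has mass 1, the constant \<open>MAX k. u $ k\<close> may be moved
  under the integral. The integrand then becomes the one-step change of the maximum.\<close>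

lemma selection_premium_eq:
  fixes D :: "(real ^ 'k::finite) measure"
  assumes "prob_space D" and sets: "sets D = sets borel"
    and int: "integrable D (\<lambda>y. MAX k. \<bar>y $ k\<bar>)"
  shows "selection_premium D u = (\<integral>y. (MAX k. (u + y) $ k) - (MAX k. u $ k) \<partial>D)"
proof -
  interpret D: prob_space D by fact
  note [measurable_cong] = sets
  have diff: "integrable D (\<lambda>y. (MAX k. (u + y) $ k) - (MAX k. u $ k))"
    using abs_Max_add_diff_le[of "\<lambda>k. u $ k" "\<lambda>k. y $ k" for y]
    by (intro Bochner_Integration.integrable_bound[OF int])
       (measurable, auto intro!: AE_I2 order_trans[OF _ abs_ge_self])
  \<comment> \<open>Splitting the integral requires the maximum itself to be integrable; this
    follows by adding the constant back to the dominated difference.\<close>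
  have "integrable D (\<lambda>y. MAX k. (u + y) $ k)"
    using Bochner_Integration.integrable_add[OF diff D.integrable_const[of "MAX k. u $ k"]] by simp
  then show ?thesis
    by (simp add: selection_premium_def D.prob_space)
qed

section \<open>Natural filtration, walk and stopping\<close>

lemma space_natural_filtration [simp]: "space (natural_filtration P N X n) = space P"
  by (simp add: natural_filtration_def space_measure_of_conv)

lemma measurable_natural_filtration:
  assumes "X i \<in> measurable P N" "1 \<le> i" "enat i \<le> n"
  shows "X i \<in> measurable (natural_filtration P N X n) N"
proof (rule measurableI)
  show "X i \<omega> \<in> space N" if "\<omega> \<in> space (natural_filtration P N X n)" for \<omega>
    using that assms(1) by (auto dest: measurable_space)
  show "X i -` A \<inter> space (natural_filtration P N X n) \<in> sets (natural_filtration P N X n)"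
    if "A \<in> sets N" for A
    unfolding space_natural_filtration unfolding natural_filtration_def
    using that assms(2,3) by (subst sets_measure_of) auto
qed

lemma sets_natural_filtration_subset:
  assumes "\<And>i. 1 \<le> i \<Longrightarrow> X i \<in> measurable P N"
  shows "sets (natural_filtration P N X n) \<subseteq> sets P"
  unfolding natural_filtration_def
  using assms by (subst sets_measure_of) (auto intro!: sets.sigma_sets_subset measurable_sets)

lemma incr_measurable:
  assumes "\<And>k. f k \<in> borel_measurable N" "X i \<in> measurable M N"
  shows "incr P X f i \<in> borel_measurable M"
proof -
  note [measurable] = assms
  have "(\<lambda>\<omega>. \<chi> k. f k (X i \<omega>) - mean P X f k) \<in> borel_measurable M"
    by (rule borel_measurable_vec_lambda) measurable
  then show ?thesis by (simp add: incr_def[abs_def])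
qed

lemma walk_Suc: "walk P X f (Suc n) \<omega> = walk P X f n \<omega> + incr P X f (Suc n) \<omega>"
  by (simp add: walk_def)

lemma walk_max_0: "walk_max P X f 0 \<omega> = 0"
  by (simp add: walk_max_def walk_def)

text \<open>The defaults at \<open>T \<omega> = \<infinity>\<close> agree because the zero vector
  has maximum 0.\<close>

lemma walk_max_stopped:
  "stopped_at (walk_max P X f) T \<omega> = (MAX k. stopped_at (walk P X f) T \<omega> $ k)"
  by (cases "T \<omega>") (simp_all add: stopped_at_def walk_max_def)

text \<open>On a path with finite \<open>T\<close> only the terms with \<open>n < T \<omega>\<close>
  survive, so the series is a finite telescoping sum, and \<open>Z 0 \<omega> = 0\<close> removes
  its lower end.\<close>

lemma sums_stopped_at:
  fixes Z :: "nat \<Rightarrow> 'a \<Rightarrow> real"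
  assumes "T \<omega> \<noteq> \<infinity>" "Z 0 \<omega> = 0"
  shows "(\<lambda>n. (Z (Suc n) \<omega> - Z n \<omega>) * indicator {\<omega>. enat (Suc n) \<le> T \<omega>} \<omega>)
    sums stopped_at Z T \<omega>"
proof -
  obtain m where m: "T \<omega> = enat m" using assms(1) by auto
  have "(\<lambda>n. (Z (Suc n) \<omega> - Z n \<omega>) * indicator {\<omega>. enat (Suc n) \<le> T \<omega>} \<omega>)
    sums (\<Sum>n<m. (Z (Suc n) \<omega> - Z n \<omega>) * indicator {\<omega>. enat (Suc n) \<le> T \<omega>} \<omega>)"
    by (rule sums_finite) (auto simp: m)
  also have "(\<Sum>n<m. (Z (Suc n) \<omega> - Z n \<omega>) * indicator {\<omega>. enat (Suc n) \<le> T \<omega>} \<omega>)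
      = (\<Sum>n<m. Z (Suc n) \<omega> - Z n \<omega>)"
    by (intro sum.cong) (auto simp: m)
  also have "\<dots> = stopped_at Z T \<omega>"
    using assms(2) sum_lessThan_telescope[of "\<lambda>n. Z n \<omega>" m] by (simp add: stopped_at_def m)
  finally show ?thesis .
qed

text \<open>As \<open>enat\<close> is countable, singletons suffice, and each event
  \<open>T = t\<close> is \<open>T \<le> t\<close> with countably many events
  \<open>T \<le> s\<close>, \<open>s < t\<close>, removed. This also covers
  \<open>t = \<infinity>\<close>.\<close>

lemma stopping_time_measurable_count_space:
  fixes T :: "'a \<Rightarrow> enat"
  assumes T: "stopping_time F T"
    and F: "\<And>t. sets (F t) \<subseteq> sets M" "\<And>t. space (F t) = space M"
  shows "T \<in> measurable M (count_space UNIV)"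
proof (subst measurable_count_space_eq2_countable, safe)
  fix t :: enat
  have le: "{\<omega> \<in> space M. T \<omega> \<le> s} \<in> sets M" for s
    using stopping_timeD[OF T, of s] F by (auto simp: pred_def)
  have "T -` {t} \<inter> space M = {\<omega> \<in> space M. T \<omega> \<le> t} - (\<Union>s\<in>{..<t}. {\<omega> \<in> space M. T \<omega> \<le> s})"
    by (auto simp: not_le le_less)
  also have "\<dots> \<in> sets M"
    using le by (intro sets.Diff sets.countable_UN') auto
  finally show "T -` {t} \<inter> space M \<in> sets M" .
qed auto

theorem theorem3p5:
  fixes P :: "'a measure" and N :: "'x measure"
    and X :: "nat \<Rightarrow> 'a \<Rightarrow> 'x" and f :: "'k::finite \<Rightarrow> 'x \<Rightarrow> real"
    and T :: "'a \<Rightarrow> enat"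
  defines "Y \<equiv> incr P X f"
    and "S \<equiv> walk P X f"
    and "F \<equiv> natural_filtration P N X"
    and "\<phi> \<equiv> selection_premium (distr P borel (incr P X f 1))"
  assumes "prob_space P"
    and X_indep: "prob_space.indep_vars P (\<lambda>_. N) X {1..}"
    and X_ident: "\<And>i. 1 \<le> i \<Longrightarrow> distr P N (X i) = distr P N (X 1)"
    and f_meas: "\<And>k. f k \<in> borel_measurable N"
    and f_mean: "\<And>k. integrable P (\<lambda>\<omega>. f k (X 1 \<omega>))"
    and A1_indep: "prob_space.indep_vars P (\<lambda>_. borel) Y {1..}"
    and A1_ident: "\<And>i. 1 \<le> i \<Longrightarrow> distr P borel (Y i) = distr P borel (Y 1)"
    and A1_past: "\<And>i. 1 \<le> i \<Longrightarrow>
      prob_space.indep_set P (sets (vimage_algebra (space P) (Y i) borel)) (sets (F (enat (i - 1))))"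
    and A2: "(\<integral>\<omega>. Y 1 \<omega> \<partial>P) = 0"
    and A3: "integrable P (\<lambda>\<omega>. MAX k. \<bar>Y 1 \<omega> $ k\<bar>)"
    and T_stop: "stopping_time F T"
    and T_mean: "(\<integral>\<^sup>+\<omega>. ennreal_of_enat (T \<omega>) \<partial>P) < \<infinity>"
  shows "integrable P (stopped_at (walk_max P X f) T)
    \<and> (\<integral>\<omega>. stopped_at (walk_max P X f) T \<omega> \<partial>P) = (\<integral>\<omega>. (MAX k. stopped_at S T \<omega> $ k) \<partial>P)
    \<and> (\<forall>i\<ge>1. integrable P (\<lambda>\<omega>. \<phi> (S (i - 1) \<omega>) * indicator {\<omega>. enat i \<le> T \<omega>} \<omega>))
    \<and> (\<lambda>n. let i = Suc n in
          \<integral>\<omega>. \<phi> (S (i - 1) \<omega>) * indicator {\<omega>. enat i \<le> T \<omega>} \<omega> \<partial>P)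
        sums (\<integral>\<omega>. stopped_at (walk_max P X f) T \<omega> \<partial>P)"
proof -
  interpret P: prob_space P by fact
  define D where "D = distr P borel (Y 1)"
  define W where "W = (\<lambda>y :: real ^ 'k. MAX k. \<bar>y $ k\<bar>)"
  define C where "C = (\<integral>y. W y \<partial>D)"
  define M where "M = walk_max P X f"
  define I where "I = (\<lambda>i \<omega>. indicator {\<omega>. enat i \<le> T \<omega>} \<omega> :: real)"
  \<comment> \<open>Indices are shifted: \<open>d n\<close> is the increment of the maximum at step
    \<open>n + 1\<close>, switched off where \<open>T \<le> n\<close>.\<close>
  define d where "d = (\<lambda>n \<omega>. (M (Suc n) \<omega> - M n \<omega>) * I (Suc n) \<omega>)"

  \<comment> \<open>Measurability and adaptedness\<close>
  have X_meas: "X i \<in> measurable P N" if "1 \<le> i" for i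
    using X_indep that by (auto simp: P.indep_vars_def)
  have Y_meas: "Y i \<in> borel_measurable P" if "1 \<le> i" for i
    using A1_indep that by (auto simp: P.indep_vars_def)
  have Y_P: "Y (Suc n) \<in> borel_measurable P" for n
    by (rule Y_meas) simp
  have F_sub: "sets (F n) \<subseteq> sets P" and F_space [simp]: "space (F n) = space P" for n
    using sets_natural_filtration_subset[of X P N] X_meas by (auto simp: F_def)
  have S_F: "S n \<in> borel_measurable (F (enat n))" for n
  proof -
    have "incr P X f i \<in> borel_measurable (F (enat n))" if "i \<in> {1..n}" for i
      unfolding F_def using that X_meas
      by (intro incr_measurable[where N = N] f_meas measurable_natural_filtration) auto
    then show ?thesis
      unfolding S_def walk_def[abs_def] by (intro borel_measurable_sum)
  qed
  \<comment> \<open>Predictability: \<open>T \<ge> n + 1\<close> means \<open>T > n\<close>, the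
    complement of \<open>T \<le> n\<close>, and so is already decided at time
    \<open>n\<close>.\<close>
  have I_F: "I (Suc n) \<in> borel_measurable (F (enat n))" for n
  proof -
    have "{\<omega>. enat (Suc n) \<le> T \<omega>} = {\<omega>. enat n < T \<omega>}"
      by (simp flip: Suc_ile_eq)
    moreover note [measurable] = stopping_timeD2[OF T_stop, of "enat n"]
    ultimately show ?thesis
      unfolding I_def indicator_def by simp
  qed
  have F_P: "g \<in> borel_measurable P" if "g \<in> borel_measurable (F n)" for g :: "'a \<Rightarrow> 'z::topological_space" and n
    using measurable_mono[of borel borel "F n" P] F_sub that by auto
  note S_P [measurable] = F_P[OF S_F] and I_P [measurable] = F_P[OF I_F]
  have T_P [measurable]: "T \<in> measurable P (count_space UNIV)"
    by (rule stopping_time_measurable_count_space[OF T_stop F_sub]) simp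
  have M_eq: "M n \<omega> = (MAX k. S n \<omega> $ k)" for n \<omega>
    by (simp add: M_def S_def walk_max_def)
  have M_P [measurable]: "M n \<in> borel_measurable P" for n
    unfolding M_eq[abs_def] by measurable
  have W_meas [measurable]: "W \<in> borel_measurable borel"
    unfolding W_def by measurable
  \<comment> \<open>\<open>undefined\<close> stands for an arbitrary coordinate.\<close>
  have W_nonneg: "0 \<le> W y" for y
    unfolding W_def by (rule order_trans[OF abs_ge_zero[of "y $ undefined"]]) (auto intro!: Max_ge)

  \<comment> \<open>Law of the increments and domination\<close>
  have D_eq: "distr P borel (Y (Suc n)) = D" for n
    using A1_ident[of "Suc n"] by (simp add: D_def)
  have D_prob: "prob_space D"
    unfolding D_def by (rule P.prob_space_distr) (simp add: Y_meas)
  have D_sets [measurable_cong]: "sets D = sets borel" by (simp add: D_def)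
  have W_D: "integrable D W"
    unfolding D_def using A3 Y_meas[of 1] by (subst integrable_distr_eq) (auto simp: W_def)
  have W_P: "integrable P (\<lambda>\<omega>. W (Y (Suc n) \<omega>))" for n
    using W_D Y_meas[of "Suc n"] unfolding D_eq[of n, symmetric]
    by (subst (asm) integrable_distr_eq) auto
  have \<phi>_eq: "\<phi> u = (\<integral>y. (MAX k. (u + y) $ k) - (MAX k. u $ k) \<partial>D)" for u
    using selection_premium_eq[OF D_prob D_sets] W_D
    by (simp add: \<phi>_def D_def Y_def W_def)
  have I_bounds: "0 \<le> I i \<omega>" "I i \<omega> \<le> 1" for i \<omega>
    by (auto simp: I_def indicator_def)
  have M_diff: "\<bar>M (Suc n) \<omega> - M n \<omega>\<bar> \<le> W (Y (Suc n) \<omega>)" for n \<omega>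
    using abs_Max_add_diff_le[of "\<lambda>k. S n \<omega> $ k" "\<lambda>k. Y (Suc n) \<omega> $ k"]
    by (simp add: M_eq W_def S_def Y_def walk_Suc)

  \<comment> \<open>Integrating out the next increment\<close>
  have Z_P: "(\<lambda>\<omega>. (S n \<omega>, I (Suc n) \<omega>)) \<in> measurable P (borel \<Otimes>\<^sub>M borel)" for n
    by measurable
  \<comment> \<open>Position and indicator are jointly measurable at time \<open>n\<close>, so the
    \<sigma>-algebra they generate inherits independence from \<open>Y (Suc n)\<close>. The
    hypothesis lists the increment first, hence the commutation.\<close>
  have indep: "P.indep_set
      (sets (vimage_algebra (space P) (\<lambda>\<omega>. (S n \<omega>, I (Suc n) \<omega>)) (borel \<Otimes>\<^sub>M borel)))
      (sets (vimage_algebra (space P) (Y (Suc n)) borel))" for n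
  proof -
    have "sets (vimage_algebra (space P) (\<lambda>\<omega>. (S n \<omega>, I (Suc n) \<omega>)) (borel \<Otimes>\<^sub>M borel))
        \<subseteq> sets (F (enat n))"
      using measurable_Pair[OF S_F I_F, of n] by (intro sets_image_in_sets) auto
    then show ?thesis
      using A1_past[of "Suc n"] by (auto simp: P.indep_sets2_eq subset_eq) (metis Int_commute mult.commute)
  qed
  \<comment> \<open>Kept general in \<open>g\<close> because it is applied twice: to the increment
    of the maximum, giving the premium, and to its dominating function, giving summability.\<close>
  have integrate_out: "integrable P (\<lambda>\<omega>. \<integral>y. g ((S n \<omega>, I (Suc n) \<omega>), y) \<partial>D)"
    "(\<integral>\<omega>. (\<integral>y. g ((S n \<omega>, I (Suc n) \<omega>), y) \<partial>D) \<partial>P)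
      = (\<integral>\<omega>. g ((S n \<omega>, I (Suc n) \<omega>), Y (Suc n) \<omega>) \<partial>P)"
    if g: "g \<in> borel_measurable ((borel \<Otimes>\<^sub>M borel) \<Otimes>\<^sub>M borel)"
      and int: "integrable P (\<lambda>\<omega>. g ((S n \<omega>, I (Suc n) \<omega>), Y (Suc n) \<omega>))"
    for g :: "((real ^ 'k) \<times> real) \<times> (real ^ 'k) \<Rightarrow> real" and n
    using P.integrable_indep_fst[OF Z_P Y_P indep g int]
      P.integral_indep_fst[OF Z_P Y_P indep g int] by (simp_all add: D_eq)
  have int_WI: "integrable P (\<lambda>\<omega>. W (Y (Suc n) \<omega>) * I (Suc n) \<omega>)" for n
    using Y_meas[of "Suc n"] I_bounds
    by (intro Bochner_Integration.integrable_bound[OF W_P[of n]])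
       (auto intro!: AE_I2 simp: W_nonneg abs_mult mult_left_le)
  \<comment> \<open>The indicator is kept in the bound: without it the expectations would be the
    same constant for all \<open>n\<close>.\<close>
  have d_bound: "norm (d n \<omega>) \<le> W (Y (Suc n) \<omega>) * I (Suc n) \<omega>" for n \<omega>
    using M_diff[of n \<omega>] I_bounds[of "Suc n" \<omega>] by (simp add: d_def abs_mult mult_right_mono)
  have d_P [measurable]: "d n \<in> borel_measurable P" for n
    unfolding d_def by measurable
  have int_d: "integrable P (d n)" for n
    using d_bound[of n] by (intro Bochner_Integration.integrable_bound[OF int_WI[of n]])
       (auto intro!: AE_I2 order_trans[OF _ abs_ge_self])
  have premium: "integrable P (\<lambda>\<omega>. \<phi> (S n \<omega>) * I (Suc n) \<omega>)"
    "(\<integral>\<omega>. \<phi> (S n \<omega>) * I (Suc n) \<omega> \<partial>P) = (\<integral>\<omega>. d n \<omega> \<partial>P)" for n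
  proof -
    \<comment> \<open>\<open>fst (fst p)\<close> is the position, \<open>snd (fst p)\<close> the
      indicator and \<open>snd p\<close> the new increment; the indicator is constant in the
      increment and leaves the inner integral.\<close>
    define g where "g = (\<lambda>p :: ((real ^ 'k) \<times> real) \<times> (real ^ 'k).
      ((MAX k. (fst (fst p) + snd p) $ k) - (MAX k. fst (fst p) $ k)) * snd (fst p))"
    have g: "g \<in> borel_measurable ((borel \<Otimes>\<^sub>M borel) \<Otimes>\<^sub>M borel)"
      unfolding g_def by measurable
    have d: "g ((S n \<omega>, I (Suc n) \<omega>), Y (Suc n) \<omega>) = d n \<omega>" for \<omega>
      by (simp add: g_def d_def M_eq S_def Y_def walk_Suc)
    have \<phi>: "(\<integral>y. g ((S n \<omega>, I (Suc n) \<omega>), y) \<partial>D) = \<phi> (S n \<omega>) * I (Suc n) \<omega>" for \<omega>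
      by (simp add: g_def \<phi>_eq)
    show "integrable P (\<lambda>\<omega>. \<phi> (S n \<omega>) * I (Suc n) \<omega>)"
      using integrate_out(1)[OF g, of n] int_d[of n] by (simp add: d D_eq \<phi>)
    show "(\<integral>\<omega>. \<phi> (S n \<omega>) * I (Suc n) \<omega> \<partial>P) = (\<integral>\<omega>. d n \<omega> \<partial>P)"
      using integrate_out(2)[OF g, of n] int_d[of n] by (simp add: d D_eq \<phi>)
  qed
  \<comment> \<open>Here the integrand ignores the position, so integrating out the increment
    factors the expectation into \<open>C\<close> and the probability that \<open>T\<close> exceeds
    \<open>n\<close>.\<close>
  have E_WI: "(\<integral>\<omega>. W (Y (Suc n) \<omega>) * I (Suc n) \<omega> \<partial>P) = C * (\<integral>\<omega>. I (Suc n) \<omega> \<partial>P)" for n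
    using integrate_out(2)[of "\<lambda>(z, y). W y * snd z" n] int_WI[of n]
    by (simp add: D_eq C_def)

  \<comment> \<open>Summability and termwise integration\<close>
  have "summable (\<lambda>n. \<integral>\<omega>. I (Suc n) \<omega> \<partial>P)"
  proof -
    have E_I: "emeasure P {\<omega> \<in> space P. enat n < T \<omega>} = ennreal (\<integral>\<omega>. I (Suc n) \<omega> \<partial>P)" for n
    proof -
      have "(\<integral>\<omega>. I (Suc n) \<omega> \<partial>P) = (\<integral>\<omega>. indicator {\<omega> \<in> space P. enat n < T \<omega>} \<omega> \<partial>P)"
        by (intro Bochner_Integration.integral_cong) (auto simp: I_def indicator_def Suc_ile_eq)
      then show ?thesis by (simp add: P.emeasure_eq_measure)
    qed
    \<comment> \<open>Tail-sum formula: the expectation of \<open>T\<close> is the sum over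
      \<open>n\<close> of the probabilities of \<open>T > n\<close>.\<close>
    have "(\<Sum>n. ennreal (\<integral>\<omega>. I (Suc n) \<omega> \<partial>P)) \<noteq> \<top>"
      using T_mean by (simp add: nn_integral_enat_function[OF T_P] E_I less_top)
    then show ?thesis
      by (intro summable_suminf_not_top) (simp_all add: I_bounds)
  qed
  then have "summable (\<lambda>n. C * (\<integral>\<omega>. I (Suc n) \<omega> \<partial>P))"
    by (rule summable_mult)
  then have summable_d: "summable (\<lambda>n. \<integral>\<omega>. norm (d n \<omega>) \<partial>P)"
  proof (rule summable_comparison_test')
    show "norm (\<integral>\<omega>. norm (d n \<omega>) \<partial>P) \<le> C * (\<integral>\<omega>. I (Suc n) \<omega> \<partial>P)" if "0 \<le> n" for n
    proof -
      have "(\<integral>\<omega>. norm (d n \<omega>) \<partial>P) \<le> C * (\<integral>\<omega>. I (Suc n) \<omega> \<partial>P)"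
        unfolding E_WI[symmetric] by (intro integral_mono integrable_norm int_d int_WI d_bound)
      then show ?thesis by simp
    qed
  qed
  have T_fin: "AE \<omega> in P. T \<omega> \<noteq> \<infinity>"
  proof -
    have "AE \<omega> in P. ennreal_of_enat (T \<omega>) \<noteq> \<infinity>"
      using T_mean by (intro nn_integral_noteq_infinite) auto
    then show ?thesis by eventually_elim (metis ennreal_of_enat_infty)
  qed
  have d_sums: "d n \<omega> = (M (Suc n) \<omega> - M n \<omega>) * indicator {\<omega>. enat (Suc n) \<le> T \<omega>} \<omega>" for n \<omega>
    by (simp add: d_def I_def)
  have sums_M: "(\<lambda>n. d n \<omega>) sums stopped_at M T \<omega>" if "T \<omega> \<noteq> \<infinity>" for \<omega>
    unfolding d_sums using that by (intro sums_stopped_at) (simp_all add: M_def walk_max_0)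
  have summable_AE: "AE \<omega> in P. summable (\<lambda>n. norm (d n \<omega>))"
    using T_fin
  proof eventually_elim
    case (elim \<omega>)
    then obtain m where "T \<omega> = enat m" by auto
    then show ?case by (intro summable_finite[of "{..<m}"]) (auto simp: d_sums)
  qed
  have stopped_P [measurable]: "stopped_at M T \<in> borel_measurable P"
    unfolding stopped_at_def[abs_def] by measurable
  have suminf_AE: "AE \<omega> in P. (\<Sum>n. d n \<omega>) = stopped_at M T \<omega>"
    using T_fin by eventually_elim (metis sums_M sums_unique)
  have suminf_P: "(\<lambda>\<omega>. \<Sum>n. d n \<omega>) \<in> borel_measurable P" by measurable
  \<comment> \<open>The series equals the stopped maximum only where \<open>T\<close> is finite, so
    integrability and the value of the integral are transferred by almost-everywhere
    equality.\<close>
  have "integrable P (stopped_at M T)"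
    using integrable_suminf[OF int_d summable_AE summable_d]
      integrable_cong_AE[OF suminf_P stopped_P suminf_AE] by simp
  moreover have "(\<lambda>n. \<integral>\<omega>. d n \<omega> \<partial>P) sums (\<integral>\<omega>. stopped_at M T \<omega> \<partial>P)"
    using sums_integral[OF int_d summable_AE summable_d]
      integral_cong_AE[OF suminf_P stopped_P suminf_AE] by simp
  moreover have "integrable P (\<lambda>\<omega>. \<phi> (S (i - 1) \<omega>) * I i \<omega>)" if "i \<ge> 1" for i
    using premium(1)[of "i - 1"] that by simp
  ultimately show ?thesis
    using premium(2) unfolding M_def I_def
    by (simp add: walk_max_stopped Let_def S_def)
qed

end
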